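(* For every infinite sequence $w=(w_1,w_2,\dots)$ with $w_i\in\{L,R\}$ and every integer $n\ge 0$, $$(\mu^L_{w(n+1)},\mu^R_{w(n+1)})=\Phi_{w_{n+1}}\bigl((\mu^L_{w(n)},\mu^R_{w(n)})\bigr).$$ In other words, $(\mu^L_{w(n)},\mu^R_{w(n)})_{n\ge 0}$ is the trajectory, starting from $(\mu_1,\mu_1)$, of the nonautonomous dynamical system on $\Delta_0(\mathbb{Z})\times\Delta_0(\mathbb{Z})$ given by the maps $\{\Phi_{w_n}\}_{n\ge 1}$.
   Context: $\mathbb{N}=\{0,1,2,\dots\}$. For $n\in\mathbb{N}$, $s(n)$ is the number of ones in the binary expansion of $n$. For $t\in\mathbb{N}$, $d\in\mathbb{Z}$, $\mu_t(d)=\lim_{N\to\infty}\frac1N|\{n<N: s(n+t)-s(n)=d\}|$. It is well known that the limit exists and $\mu_t$ is a probability measure on $\mathbb{Z}$ with mean zero. $\Delta(\mathbb{Z})$ is the set of probability measures on $\mathbb{Z}$ (identified with $(P(k))_{k\in\mathbb{Z}}$), and $\Delta_0(\mathbb{Z})$ is the set of those with finite first absolute moment and mean $0$. The shift $\sigma_d:\Delta(\mathbb{Z})\to\Delta(\mathbb{Z})$ is $(\sigma_dP)(k)=P(k-d)$; $\sigma_L:=\sigma_{-1}$, $\sigma_R:=\sigma_1$. Define $\Phi(\mu,\nu)=\frac12\sigma_L(\mu)+\frac12\sigma_R(\nu)$ for $\mu,\nu\in\Delta_0(\mathbb{Z})$, and maps $\Phi_L,\Phi_R$ from $\Delta_0(\mathbb{Z})\times\Delta_0(\mathbb{Z})$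 to itself by $\Phi_L(\mu,\nu)=(\Phi(\mu,\nu),\nu)$ and $\Phi_R(\mu,\nu)=(\mu,\Phi(\mu,\nu))$. On odd positive integers let $L(t)=2t-1$, $R(t)=2t+1$. For $w=(w_1,w_2,\dots)\in\{L,R\}^{\mathbb{N}}$ set $w(0)=3$ and $w(n)=w_n\circ\cdots\circ w_1(3)$ for $n\ge1$. For an odd integer $t=2s+1\ge 3$ set $\mu^L_t:=\mu_{s+1}$ and $\mu^R_t:=\mu_s$. *)

theory Defs
  imports "HOL-Probability.Probability"
begin

definition bin_ones :: "nat \<Rightarrow> nat" where
  "bin_ones n = card {i. bit n i}"

definition diff_freq :: "nat \<Rightarrow> int \<Rightarrow> nat \<Rightarrow> real" where
  "diff_freq t d N =
     real (card {n. n < N \<and> int (bin_ones (n + t)) - int (bin_ones n) = d}) / real N"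

text \<open>
  Probability measures on the integers are represented by the type \<^typ>\<open>int pmf\<close>.
  Applying \<^const>\<open>embed_pmf\<close> and \<^const>\<open>lim\<close> is legitimate because the limits exist and
  form a probability mass function; see \<open>diff_freq_tendsto_mu\<close> below.
\<close>

definition mu :: "nat \<Rightarrow> int pmf" where
  "mu t = embed_pmf (\<lambda>d. lim (diff_freq t d))"

definition Delta0 :: "int pmf set" where
  "Delta0 = {P. integrable (measure_pmf P) real_of_int \<and> measure_pmf.expectation P real_of_int = 0}"

definition shift :: "int \<Rightarrow> int pmf \<Rightarrow> int pmf" where
  "shift d P = map_pmf (\<lambda>k. k + d) P"

lemma pmf_shift: "pmf (shift d P) k = pmf P (k - d)"
proof -
  have "inj (\<lambda>k::int. k + d)"
    by (simp add: inj_def)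
  from pmf_map_inj'[OF this, of P "k - d"] show ?thesis
    by (simp add: shift_def)
qed

abbreviation shift_L :: "int pmf \<Rightarrow> int pmf" where "shift_L \<equiv> shift (-1)"
abbreviation shift_R :: "int pmf \<Rightarrow> int pmf" where "shift_R \<equiv> shift 1"

text \<open>The convex combination with weights 1/2 is the law of a fair choice between two measures.\<close>

definition Phi :: "int pmf \<Rightarrow> int pmf \<Rightarrow> int pmf" where
  "Phi \<mu> \<nu> = bind_pmf (bernoulli_pmf (1/2)) (\<lambda>b. if b then shift_L \<mu> else shift_R \<nu>)"

lemma pmf_Phi: "pmf (Phi \<mu> \<nu>) k = 1/2 * pmf (shift_L \<mu>) k + 1/2 * pmf (shift_R \<nu>) k"
  by (simp add: Phi_def pmf_bind)

datatype dir = L | R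

text \<open>Truncated subtraction is harmless: the arguments of interest are at least 3.\<close>

fun odd_step :: "dir \<Rightarrow> nat \<Rightarrow> nat" where
  "odd_step L t = 2 * t - 1"
| "odd_step R t = 2 * t + 1"

fun Phi_map :: "dir \<Rightarrow> int pmf \<times> int pmf \<Rightarrow> int pmf \<times> int pmf" where
  "Phi_map L (\<mu>, \<nu>) = (Phi \<mu> \<nu>, \<nu>)"
| "Phi_map R (\<mu>, \<nu>) = (\<mu>, Phi \<mu> \<nu>)"

text \<open>Orbit of a point under the composition \<open>F n \<circ> \<dots> \<circ> F 1\<close>; the value \<open>F 0\<close> is not used.\<close>

primrec trajectory :: "(nat \<Rightarrow> 'a \<Rightarrow> 'a) \<Rightarrow> 'a \<Rightarrow> nat \<Rightarrow> 'a" where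
  "trajectory F x 0 = x"
| "trajectory F x (Suc n) = F (Suc n) (trajectory F x n)"

definition odd_seq :: "(nat \<Rightarrow> dir) \<Rightarrow> nat \<Rightarrow> nat" where
  "odd_seq w n = trajectory (\<lambda>i. odd_step (w i)) 3 n"

text \<open>For \<open>t = 2 * s + 1\<close> these are \<open>mu (s + 1)\<close> and \<open>mu s\<close>.\<close>

definition mu_L :: "nat \<Rightarrow> int pmf" where "mu_L t = mu ((t - 1) div 2 + 1)"
definition mu_R :: "nat \<Rightarrow> int pmf" where "mu_R t = mu ((t - 1) div 2)"

subsection \<open>The limits defining \<open>mu\<close> exist\<close>

lemma finite_bits: "finite {i. bit (n::nat) i}"
proof (rule finite_subset)
  show "{i. bit n i} \<subseteq> {..n}"
  proof
    fix i assume "i \<in> {i. bit n i}"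
    then have "odd (n div 2 ^ i)" by (simp add: bit_iff_odd)
    then have "2 ^ i \<le> n" by (metis div_less even_zero not_less)
    then show "i \<in> {..n}" using order.strict_trans2[OF less_exp[of i]] by (simp add: less_imp_le)
  qed
qed simp

lemma bin_ones_double: "bin_ones (2 * n) = bin_ones n"
proof -
  have "{i. bit (2 * n) i} = Suc ` {i. bit n i}"
  proof (rule set_eqI)
    fix i show "i \<in> {i. bit (2 * n) i} \<longleftrightarrow> i \<in> Suc ` {i. bit n i}"
      by (cases i) (auto simp: bit_0 bit_Suc)
  qed
  then show ?thesis by (simp add: bin_ones_def card_image)
qed

lemma bin_ones_Suc_double: "bin_ones (Suc (2 * n)) = Suc (bin_ones n)"
proof -
  have "{i. bit (Suc (2 * n)) i} = insert 0 (Suc ` {i. bit n i})"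
  proof (rule set_eqI)
    fix i show "i \<in> {i. bit (Suc (2 * n)) i} \<longleftrightarrow> i \<in> insert 0 (Suc ` {i. bit n i})"
      by (cases i) (auto simp: bit_0 bit_Suc)
  qed
  moreover have "card (insert 0 (Suc ` {i. bit n i})) = Suc (card (Suc ` {i. bit n i}))"
    by (rule card_insert_disjoint) (auto simp: finite_bits)
  ultimately show ?thesis by (simp add: bin_ones_def card_image)
qed

definition diff_count :: "nat \<Rightarrow> int \<Rightarrow> nat \<Rightarrow> nat" where
  "diff_count t d N = card {n. n < N \<and> int (bin_ones (n + t)) - int (bin_ones n) = d}"

lemma diff_count_0: "diff_count t d 0 = 0"
  by (simp add: diff_count_def)

lemma diff_count_Suc:
  "diff_count t d (Suc N) =
     diff_count t d N + (if int (bin_ones (N + t)) - int (bin_ones N) = d then 1 else 0)"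
proof -
  let ?P = "\<lambda>n. int (bin_ones (n + t)) - int (bin_ones n) = d"
  have "{n. n < Suc N \<and> ?P n} = (if ?P N then insert N {n. n < N \<and> ?P n} else {n. n < N \<and> ?P n})"
    by (auto simp: less_Suc_eq)
  then show ?thesis by (simp add: diff_count_def)
qed

lemma diff_count_double_even: "diff_count (2 * s) d (2 * M) = 2 * diff_count s d M"
proof (induction M)
  case (Suc M)
  have "2 * M + 2 * s = 2 * (M + s)" "Suc (2 * M) + 2 * s = Suc (2 * (M + s))" by simp_all
  then have a: "bin_ones (2 * M + 2 * s) = bin_ones (M + s)"
    "bin_ones (Suc (2 * M) + 2 * s) = Suc (bin_ones (M + s))"
    by (simp_all only: bin_ones_double bin_ones_Suc_double)
  have "2 * Suc M = Suc (Suc (2 * M))" by simp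
  then show ?case
    unfolding diff_count_Suc a bin_ones_double bin_ones_Suc_double
      \<open>2 * Suc M = Suc (Suc (2 * M))\<close> Suc.IH by auto
qed (simp add: diff_count_0)

lemma diff_count_double_odd:
  "diff_count (2 * s + 1) d (2 * M) = diff_count s (d - 1) M + diff_count (s + 1) (d + 1) M"
proof (induction M)
  case (Suc M)
  have "2 * M + (2 * s + 1) = Suc (2 * (M + s))" "Suc (2 * M) + (2 * s + 1) = 2 * (M + (s + 1))"
    by simp_all
  then have a: "bin_ones (2 * M + (2 * s + 1)) = Suc (bin_ones (M + s))"
    "bin_ones (Suc (2 * M) + (2 * s + 1)) = bin_ones (M + (s + 1))"
    by (simp_all only: bin_ones_double bin_ones_Suc_double)
  have "2 * Suc M = Suc (Suc (2 * M))" by simp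
  then show ?case
    unfolding diff_count_Suc a bin_ones_double bin_ones_Suc_double
      \<open>2 * Suc M = Suc (Suc (2 * M))\<close> Suc.IH by auto
qed (simp add: diff_count_0)

lemma diff_freq_even_imp:
  assumes "(\<lambda>M. diff_freq t d (2 * M)) \<longlonglongrightarrow> x"
  shows "diff_freq t d \<longlonglongrightarrow> x"
proof (rule limseq_even_odd)
  let ?e = "\<lambda>M. diff_freq t d (2 * M + 1) - diff_freq t d (2 * M) * (real (2 * M) / real (2 * M + 1))"
  have e: "0 \<le> ?e M \<and> ?e M \<le> 1 / real (2 * M + 1)" for M
  proof -
    have "diff_freq t d (2 * M) * (real (2 * M) / real (2 * M + 1))
        = real (diff_count t d (2 * M)) / real (2 * M + 1)"
      by (cases "M = 0") (simp_all add: diff_freq_def diff_count_def)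
    moreover have "diff_freq t d (2 * M + 1) = real (diff_count t d (2 * M + 1)) / real (2 * M + 1)"
      by (simp add: diff_freq_def diff_count_def)
    ultimately have "?e M = (real (diff_count t d (2 * M + 1)) - real (diff_count t d (2 * M)))
        / real (2 * M + 1)" by (simp add: diff_divide_distrib)
    then show ?thesis by (simp add: diff_count_Suc)
  qed
  have z: "(\<lambda>M. 1 / real (2 * M + 1)) \<longlonglongrightarrow> 0" by real_asymp
  have "?e \<longlonglongrightarrow> 0"
    by (rule tendsto_sandwich[OF _ _ tendsto_const z]) (use e in auto)
  moreover have "(\<lambda>M. real (2 * M) / real (2 * M + 1)) \<longlonglongrightarrow> 1" by real_asymp
  ultimately have "(\<lambda>M. ?e M + diff_freq t d (2 * M) * (real (2 * M) / real (2 * M + 1)))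
      \<longlonglongrightarrow> 0 + x * 1"
    by (intro tendsto_intros assms)
  then show "(\<lambda>M. diff_freq t d (2 * M + 1)) \<longlonglongrightarrow> x" by simp
qed (rule assms)

lemma diff_freq_double_even: "diff_freq (2 * s) d (2 * M) = diff_freq s d M"
  using diff_count_double_even[of s d M] by (simp add: diff_freq_def diff_count_def)

lemma diff_freq_double_odd:
  "diff_freq (2 * s + 1) d (2 * M) = 1/2 * diff_freq s (d - 1) M + 1/2 * diff_freq (s + 1) (d + 1) M"
proof -
  have f: "diff_freq t d N = real (diff_count t d N) / real N" for t d N
    by (simp add: diff_freq_def diff_count_def)
  show ?thesis unfolding f diff_count_double_odd by (simp add: add_divide_distrib)
qed

lemma diff_freq_even_limit:
  assumes "diff_freq s d \<longlonglongrightarrow> x"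
  shows "diff_freq (2 * s) d \<longlonglongrightarrow> x"
  using assms by (intro diff_freq_even_imp) (simp add: diff_freq_double_even)

lemma diff_freq_odd_limit:
  assumes "diff_freq s (d - 1) \<longlonglongrightarrow> x" "diff_freq (s + 1) (d + 1) \<longlonglongrightarrow> y"
  shows "diff_freq (2 * s + 1) d \<longlonglongrightarrow> 1/2 * x + 1/2 * y"
  by (intro diff_freq_even_imp) (unfold diff_freq_double_odd, intro tendsto_intros assms)

lemma diff_freq_0_limit: "diff_freq 0 d \<longlonglongrightarrow> (if d = 0 then 1 else 0)"
proof -
  have "eventually (\<lambda>N. (if d = 0 then 1 else 0) = diff_freq 0 d N) sequentially"
    using eventually_gt_at_top[of 0] by eventually_elim (auto simp: diff_freq_def)
  then show ?thesis by (rule tendsto_eventually[OF eventually_mono]) auto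
qed

lemma bin_ones_Suc_le: "bin_ones (Suc n) \<le> Suc (bin_ones n)"
proof (induction n rule: less_induct)
  case (less n)
  show ?case
  proof (cases "even n")
    case True
    then obtain m where "n = 2 * m" by (elim evenE)
    then show ?thesis by (simp add: bin_ones_double bin_ones_Suc_double)
  next
    case False
    then obtain m where m: "n = Suc (2 * m)" by (metis oddE Suc_eq_plus1)
    have "bin_ones (Suc n) = bin_ones (2 * Suc m)" by (simp add: m)
    with less.IH[of m] show ?thesis unfolding m
      by (simp add: bin_ones_double bin_ones_Suc_double del: mult_Suc_right)
  qed
qed

lemma diff_freq_1_limit_pos:
  assumes "d > 1"
  shows "diff_freq 1 d \<longlonglongrightarrow> 0"
proof -
  have "int (bin_ones (n + 1)) - int (bin_ones n) \<noteq> d" for n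
    using bin_ones_Suc_le[of n] assms by simp
  then have "diff_freq 1 d = (\<lambda>_. 0)" by (simp add: diff_freq_def fun_eq_iff)
  then show ?thesis by simp
qed

lemma diff_freq_1_limit: "diff_freq 1 (1 - int k) \<longlonglongrightarrow> (1/2) ^ Suc k"
proof (induction k)
  case 0
  show ?case
    using diff_freq_odd_limit[of 0 1 1 0] diff_freq_0_limit[of 0] diff_freq_1_limit_pos[of 2] by simp
next
  case (Suc k)
  have "diff_freq 1 (1 - int (Suc k) + 1) \<longlonglongrightarrow> (1/2) ^ Suc k" using Suc by simp
  moreover have "diff_freq 0 (1 - int (Suc k) - 1) \<longlonglongrightarrow> 0"
    using diff_freq_0_limit[of "1 - int (Suc k) - 1"] by simp
  ultimately show ?case
    using diff_freq_odd_limit[of 0 "1 - int (Suc k)" 0 "(1/2) ^ Suc k"] by simp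
qed

lemma diff_freq_limit_pmf: "\<exists>P :: int pmf. \<forall>d. diff_freq t d \<longlonglongrightarrow> pmf P d"
proof (induction t rule: less_induct)
  case (less t)
  consider "t = 0" | "t = 1" | s where "t = 2 * s" "s < t" | s where "t = 2 * s + 1" "s > 0"
  proof (cases "even t")
    case True
    then obtain b where "t = 2 * b" by (elim evenE)
    then show ?thesis using that(1) that(3)[of b] by (cases "b = 0") auto
  next
    case False
    then obtain b where "t = 2 * b + 1" by (elim oddE)
    then show ?thesis using that(2) that(4)[of b] by (cases "b = 0") auto
  qed
  then show ?case
  proof cases
    case 1
    have "diff_freq 0 d \<longlonglongrightarrow> pmf (return_pmf 0) d" for d
      using diff_freq_0_limit[of d] by (cases "d = 0") simp_all
    with 1 show ?thesis by blast
  next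
    case 2
    let ?P = "map_pmf (\<lambda>k. 1 - int k) (geometric_pmf (1/2))"
    have inj: "inj (\<lambda>k. 1 - int k)" by (simp add: inj_def)
    have "diff_freq 1 d \<longlonglongrightarrow> pmf ?P d" for d
    proof (cases "d > 1")
      case True
      then have "pmf ?P d = 0" by (auto simp: pmf_eq_0_set_pmf)
      with True show ?thesis using diff_freq_1_limit_pos by simp
    next
      case False
      then obtain k where d: "d = 1 - int k"
        using zero_le_imp_eq_int[of "1 - d"] by (auto simp: algebra_simps)
      have "pmf ?P (1 - int k) = (1/2) ^ Suc k"
        by (subst pmf_map_inj'[OF inj]) simp
      with diff_freq_1_limit[of k] show ?thesis unfolding d by (simp only:)
    qed
    with 2 show ?thesis by blast
  next
    case 3
    with less.IH[of s] show ?thesis using diff_freq_even_limit by blast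
  next
    case (4 s)
    then obtain P Q where "\<And>d. diff_freq s d \<longlonglongrightarrow> pmf P d" "\<And>d. diff_freq (s + 1) d \<longlonglongrightarrow> pmf Q d"
      using less.IH[of s] less.IH[of "s + 1"] by auto
    then have "diff_freq t d \<longlonglongrightarrow> pmf (Phi Q P) d" for d
      using diff_freq_odd_limit[of s d "pmf P (d - 1)" "pmf Q (d + 1)"] 4
      by (simp add: pmf_Phi pmf_shift add.commute)
    then show ?thesis by blast
  qed
qed

lemma diff_freq_tendsto_mu: "diff_freq t d \<longlonglongrightarrow> pmf (mu t) d"
proof -
  from diff_freq_limit_pmf obtain P :: "int pmf" where P: "\<And>d. diff_freq t d \<longlonglongrightarrow> pmf P d"
    by blast
  have "mu t = embed_pmf (pmf P)"
    unfolding mu_def using limI[OF P] by simp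
  also have "\<dots> = P"
    by (rule type_definition.Rep_inverse[OF td_pmf_embed_pmf])
  finally show ?thesis using P by simp
qed

end

theory Submission
  imports Defs
begin

text \<open>Splitting \<open>n\<close> by parity, with a last binary digit 0 or 1 removed, yields in
  the limit \<open>mu (2 * s) = mu s\<close> and
  \<open>mu (2 * s + 1) = Phi (mu (s + 1)) (mu s)\<close> (\<open>mu_double\<close>,
  \<open>mu_double_Suc\<close>). An odd \<open>t = 2 * s + 1\<close> carries the pair
  \<open>(mu (s + 1), mu s)\<close>; its step replaces \<open>s\<close> by \<open>2 * s\<close> or
  \<open>2 * s + 1\<close>. Of the two new indices the even one gives back an old entry, and
  \<open>2 * s + 1\<close> gives \<open>Phi\<close> of the old pair (\<open>mu_odd_step\<close>).
  Induction on \<open>n\<close> then yields the trajectory. \<open>Phi\<close> preserves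
  \<open>Delta0\<close> because its opposite unit shifts cancel in the mean.\<close>

lemma mu_double: "mu (2 * s) = mu s"
  by (rule pmf_eqI)
    (rule LIMSEQ_unique[OF diff_freq_tendsto_mu diff_freq_even_limit[OF diff_freq_tendsto_mu]])

lemma mu_double_Suc: "mu (2 * s + 1) = Phi (mu (s + 1)) (mu s)"
proof (rule pmf_eqI)
  fix d
  have "diff_freq (2 * s + 1) d \<longlonglongrightarrow> 1/2 * pmf (mu s) (d - 1) + 1/2 * pmf (mu (s + 1)) (d + 1)"
    by (intro diff_freq_odd_limit diff_freq_tendsto_mu)
  with diff_freq_tendsto_mu
  have "pmf (mu (2 * s + 1)) d = 1/2 * pmf (mu s) (d - 1) + 1/2 * pmf (mu (s + 1)) (d + 1)"
    by (rule LIMSEQ_unique)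
  then show "pmf (mu (2 * s + 1)) d = pmf (Phi (mu (s + 1)) (mu s)) d"
    by (simp add: pmf_Phi pmf_shift)
qed

lemma mu_odd_step:
  assumes "odd t"
  shows "(mu_L (odd_step a t), mu_R (odd_step a t)) = Phi_map a (mu_L t, mu_R t)"
proof -
  obtain s where t: "t = 2 * s + 1"
    using assms by (elim oddE)
  have tL: "(2 * t - 1 - 1) div 2 = 2 * s" and tR: "(2 * t + 1 - 1) div 2 = 2 * s + 1"
    \<comment> \<open>\<open>s2\<close> exposes the even index after an \<open>R\<close> step, so
      that \<open>mu_double\<close> applies to it.\<close>
    and s: "(t - 1) div 2 = s" and s2: "2 * s + 1 + 1 = 2 * (s + 1)"
    by (simp_all add: t)
  show ?thesis
    by (cases a) (simp_all only: odd_step.simps Phi_map.simps mu_L_def mu_R_def tL tR s s2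
        mu_double mu_double_Suc)
qed

lemma odd_odd_seq: "odd (odd_seq w n)"
proof (induction n)
  case (Suc n)
  \<comment> \<open>Positivity keeps the truncated \<open>2 * t - 1\<close> odd; at 0 it would be
    0.\<close>
  then have "odd_seq w n > 0"
    by (rule odd_pos)
  then show ?case
    by (cases "w (Suc n)") (simp_all add: odd_seq_def)
qed (simp add: odd_seq_def)

text \<open>\<open>pmf_Phi\<close> is an identity between point masses. Against counting measure the
  masses move into the integrand, where linearity can use it.\<close>

lemma integrable_measure_pmf_iff_count_space:
  fixes f :: "'a \<Rightarrow> real"
  shows "integrable (measure_pmf P) f \<longleftrightarrow> integrable (count_space UNIV) (\<lambda>x. pmf P x * f x)"
  unfolding measure_pmf_eq_density by (subst integrable_density) auto

lemma expectation_eq_integral_count_space: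
  fixes f :: "'a \<Rightarrow> real"
  shows "measure_pmf.expectation P f = (\<integral>x. pmf P x * f x \<partial>count_space UNIV)"
  unfolding measure_pmf_eq_density by (subst integral_density) auto

lemma integrable_shift:
  assumes "integrable (measure_pmf P) real_of_int"
  shows "integrable (measure_pmf (shift d P)) real_of_int"
  using assms by (simp add: shift_def)

lemma expectation_shift:
  assumes "integrable (measure_pmf P) real_of_int"
  shows "measure_pmf.expectation (shift d P) real_of_int =
    measure_pmf.expectation P real_of_int + real_of_int d"
  using assms by (simp add: shift_def)

lemma Phi_in_Delta0:
  assumes "\<mu> \<in> Delta0" "\<nu> \<in> Delta0"
  shows "Phi \<mu> \<nu> \<in> Delta0"
proof -
  let ?h = "\<lambda>P k. pmf P k * real_of_int k"
  have i: "integrable (count_space UNIV) (?h (shift_L \<mu>))"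
    "integrable (count_space UNIV) (?h (shift_R \<nu>))"
    using assms integrable_shift
    by (auto simp: Delta0_def simp flip: integrable_measure_pmf_iff_count_space)
  have h: "?h (Phi \<mu> \<nu>) = (\<lambda>k. 1/2 * ?h (shift_L \<mu>) k + 1/2 * ?h (shift_R \<nu>) k)"
    by (simp add: pmf_Phi fun_eq_iff algebra_simps)
  have "integrable (measure_pmf (Phi \<mu> \<nu>)) real_of_int"
    unfolding integrable_measure_pmf_iff_count_space h
    by (intro Bochner_Integration.integrable_add integrable_mult_right i)
  moreover have "measure_pmf.expectation (Phi \<mu> \<nu>) real_of_int =
      1/2 * measure_pmf.expectation (shift_L \<mu>) real_of_int +
      1/2 * measure_pmf.expectation (shift_R \<nu>) real_of_int"
    unfolding expectation_eq_integral_count_space h using i by simp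
  \<comment> \<open>The shifted means are -1 and 1, with average 0.\<close>
  ultimately show ?thesis
    using assms by (simp add: Delta0_def expectation_shift)
qed

lemma Phi_map_Delta0: "Phi_map a \<in> Delta0 \<times> Delta0 \<rightarrow> Delta0 \<times> Delta0"
  by (cases a) (auto intro: Phi_in_Delta0)

text \<open>If \<open>n\<close> ends in exactly \<open>k\<close> ones, the carry in
  \<open>n + 1\<close> clears them and sets one digit; such \<open>n\<close> have density
  \<open>(1/2) ^ Suc k\<close>.\<close>

lemma mu_1: "mu 1 = map_pmf (\<lambda>k. 1 - int k) (geometric_pmf (1/2))"
proof (rule pmf_eqI)
  fix d
  have inj: "inj (\<lambda>k. 1 - int k)"
    by (simp add: inj_def)
  show "pmf (mu 1) d = pmf (map_pmf (\<lambda>k. 1 - int k) (geometric_pmf (1/2))) d"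
  proof (cases "d > 1")
    case True
    then have "pmf (map_pmf (\<lambda>k. 1 - int k) (geometric_pmf (1/2))) d = 0"
      by (auto simp: pmf_eq_0_set_pmf)
    with LIMSEQ_unique[OF diff_freq_tendsto_mu diff_freq_1_limit_pos[OF True]] show ?thesis
      by simp
  next
    case False
    then obtain k where d: "d = 1 - int k"
      using zero_le_imp_eq_int[of "1 - d"] by (auto simp: algebra_simps)
    have "pmf (map_pmf (\<lambda>k. 1 - int k) (geometric_pmf (1/2))) (1 - int k) = (1/2) ^ Suc k"
      by (subst pmf_map_inj'[OF inj]) simp
    with LIMSEQ_unique[OF diff_freq_tendsto_mu diff_freq_1_limit[of k]] show ?thesis
      by (simp only: d)
  qed
qed

lemma mu_1_in_Delta0: "mu 1 \<in> Delta0"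
  unfolding Delta0_def mu_1
  \<comment> \<open>The geometric law counts failures from 0, so its mean at 1/2 is 1.\<close>
  using integrable_real_geometric_pmf[of "1/2"] expectation_geometric_pmf[of "1/2"] by simp

theorem proposition5:
  fixes w :: "nat \<Rightarrow> dir"
  shows "(\<forall>n. (mu_L (odd_seq w (n + 1)), mu_R (odd_seq w (n + 1)))
            = Phi_map (w (n + 1)) (mu_L (odd_seq w n), mu_R (odd_seq w n)))
       \<and> (\<forall>a. Phi_map a \<in> Delta0 \<times> Delta0 \<rightarrow> Delta0 \<times> Delta0)
       \<and> (mu 1, mu 1) \<in> Delta0 \<times> Delta0
       \<and> (\<forall>n. (mu_L (odd_seq w n), mu_R (odd_seq w n))
            = trajectory (\<lambda>i. Phi_map (w i)) (mu 1, mu 1) n)"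
proof -
  have step: "(mu_L (odd_seq w (n + 1)), mu_R (odd_seq w (n + 1)))
      = Phi_map (w (n + 1)) (mu_L (odd_seq w n), mu_R (odd_seq w n))" for n
    using mu_odd_step[OF odd_odd_seq, of "w (n + 1)" w n] by (simp add: odd_seq_def)
  have "(mu_L (odd_seq w n), mu_R (odd_seq w n))
      = trajectory (\<lambda>i. Phi_map (w i)) (mu 1, mu 1) n" for n
  proof (induction n)
    case 0
    \<comment> \<open>The start 3 has \<open>s = 1\<close>, hence the pair
      \<open>(mu 2, mu 1)\<close>, and \<open>mu 2 = mu 1\<close>.\<close>
    show ?case
      using mu_double[of 1] by (simp add: odd_seq_def mu_L_def mu_R_def numeral_2_eq_2)
  next
    case (Suc n)
    with step[of n] show ?case
      by simp
  qed
  with step Phi_map_Delta0 mu_1_in_Delta0 show ?thesis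
    by blast
qed

end
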